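(* For every $n\geq 1$, the pseudoreachability order on $\mathfrak{S}_n$ coincides with the bubble-sorting order on $\mathfrak{S}_n$; that is, for all $x,y\in\mathfrak{S}_n$, $x\geq_P y$ if and only if $\lambda(x)\geq_C\lambda(y)$.
   Context: Notation: $[m,n]=\{m,\dots,n\}$, $[n]=[1,n]$. $\leq_C$ denotes componentwise order on integer vectors. For $x\in[n]^n$ the conjugate is $x^*=(n+1-x(n),\dots,n+1-x(1))$. $\mathfrak{S}_n$ is the group of permutations of $[n]$, with products composed right to left, and $s_i$ is the transposition of $i$ and $i+1$. Parking functions: cars $1,\dots,n$ enter, in this order, a one-way street with spots $1,\dots,n$. Given $a\in[n]^n$, car $i$ parks in the first (lowest-numbered) available spot in $[a(i),n]$; if there is none, the procedure fails. If all cars park, $a$ is a parking function, and its outcome is the permutation $\mathcal{O}(a)=w\in\mathfrak{S}_n$, where car $i$ parks in spot $w(i)$. Interval parking functions (IPFs): given $a,b\in[n]^n$ with $a\leq_C b$, car $i$ parks in the first available spot in $[a(i),b(i)]$; if there is none, the procedure fails. If all cars park, $(a,b)$ is an interval parking function. If $(a,b)$ is an IPF, then both $a$ and $b^*$ are parking functions. Reachability: $x\unrhd_R y$ means there exists an IPF $(a,b)$ with $x=\mathcal{O}(a)$ and $y=\mathcal{O}(b^* )^*$. Pseudoreachability $\geq_P$ is the transitive closure of $\unrhd_R$ on $\mathfrak{S}_n$; it is a partial order. Bubble-sorting order: for $1\le k\le n-1$ let $\sigma_k$ be the word $s_1s_2\cdots s_k$. Every $x\in\mathfrak{S}_n$ has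 a unique conormal form: a reduced word for $x$ of the form $v_{n-1}v_{n-2}\cdots v_2v_1$, where each $v_k$ is a (possibly empty) suffix $s_js_{j+1}\cdots s_k$ of $\sigma_k$. Put $\lambda(x)=(|v_{n-1}|,\dots,|v_1|)\in[0,n-1]\times[0,n-2]\times\cdots\times[0,1]$, where $|v_k|$ is the number of letters of $v_k$. The bubble-sorting order on $\mathfrak{S}_n$ is the partial order in which $x\geq y$ if and only if $\lambda(x)\geq_C\lambda(y)$. *)

theory Defs
  imports "HOL-Combinatorics.Permutations" "HOL-Library.Sublist"
begin

text \<open>
  Vectors in \<open>[n]\<^sup>n\<close> are functions \<open>nat \<Rightarrow> nat\<close> of which only the values on \<open>{1..n}\<close> matter, and the
  symmetric group on \<open>[n]\<close> consists of the functions \<open>w\<close> with \<open>w permutes {1..n}\<close>.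
\<close>

definition vectors :: "nat \<Rightarrow> (nat \<Rightarrow> nat) set" where
  "vectors n = {1..n} \<rightarrow> {1..n}"

text \<open>The conjugate is the identity outside \<open>{1..n}\<close>, so that conjugates of permutations are permutations.\<close>

definition conjugate :: "nat \<Rightarrow> (nat \<Rightarrow> nat) \<Rightarrow> nat \<Rightarrow> nat" where
  "conjugate n x = (\<lambda>i. if i \<in> {1..n} then n + 1 - x (n + 1 - i) else i)"


subsection \<open>Parking\<close>

text \<open>
  \<open>park a b m\<close> is the result of parking cars \<open>1, \<dots>, m\<close>, car \<open>i\<close> having preference interval
  \<open>{a i..b i}\<close>: \<open>None\<close> if the procedure fails, and otherwise \<open>Some w\<close>, where car \<open>i \<le> m\<close> has parked in
  spot \<open>w i\<close> (with \<open>w i = i\<close> for \<open>i\<close> outside \<open>{1..m}\<close>).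
\<close>

primrec park :: "(nat \<Rightarrow> nat) \<Rightarrow> (nat \<Rightarrow> nat) \<Rightarrow> nat \<Rightarrow> (nat \<Rightarrow> nat) option" where
  "park a b 0 = Some id"
| "park a b (Suc m) =
     (case park a b m of
        None \<Rightarrow> None
      | Some w \<Rightarrow>
          (let avail = {a (Suc m)..b (Suc m)} - w ` {1..m}
           in if avail = {} then None else Some (w(Suc m := Min avail))))"

definition parking_function :: "nat \<Rightarrow> (nat \<Rightarrow> nat) \<Rightarrow> bool" where
  "parking_function n a \<longleftrightarrow> a \<in> vectors n \<and> park a (\<lambda>_. n) n \<noteq> None"

text \<open>The outcome is meaningful only when \<open>a\<close> is a parking function.\<close>

definition outcome :: "nat \<Rightarrow> (nat \<Rightarrow> nat) \<Rightarrow> nat \<Rightarrow> nat" where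
  "outcome n a = the (park a (\<lambda>_. n) n)"

definition interval_parking_function :: "nat \<Rightarrow> (nat \<Rightarrow> nat) \<Rightarrow> (nat \<Rightarrow> nat) \<Rightarrow> bool" where
  "interval_parking_function n a b \<longleftrightarrow>
     a \<in> vectors n \<and> b \<in> vectors n \<and> (\<forall>i\<in>{1..n}. a i \<le> b i) \<and> park a b n \<noteq> None"


subsection \<open>Reachability and pseudoreachability\<close>

text \<open>
  If \<open>(a, b)\<close> is an interval parking function then \<open>a\<close> and \<open>conjugate n b\<close> are parking functions, so
  both outcomes below are genuine and \<open>reachable n\<close> relates permutations of \<open>{1..n}\<close> only.
\<close>

definition reachable :: "nat \<Rightarrow> (nat \<Rightarrow> nat) \<Rightarrow> (nat \<Rightarrow> nat) \<Rightarrow> bool" where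
  "reachable n x y \<longleftrightarrow>
     (\<exists>a b. interval_parking_function n a b \<and> x = outcome n a \<and>
            y = conjugate n (outcome n (conjugate n b)))"

definition pseudoreachable :: "nat \<Rightarrow> (nat \<Rightarrow> nat) \<Rightarrow> (nat \<Rightarrow> nat) \<Rightarrow> bool" where
  "pseudoreachable n = (reachable n)\<^sup>+\<^sup>+"


subsection \<open>The bubble-sorting order\<close>

text \<open>Words are lists of indices, the letter \<open>i\<close> standing for the transposition of \<open>i\<close> and \<open>i + 1\<close>.\<close>

definition word_perm :: "nat list \<Rightarrow> nat \<Rightarrow> nat" where
  "word_perm u = foldr (\<lambda>i p. transpose i (Suc i) \<circ> p) u id"

definition reduced_word :: "nat \<Rightarrow> nat list \<Rightarrow> (nat \<Rightarrow> nat) \<Rightarrow> bool" where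
  "reduced_word n u x \<longleftrightarrow>
     set u \<subseteq> {1..<n} \<and> word_perm u = x \<and>
     (\<forall>u'. set u' \<subseteq> {1..<n} \<and> word_perm u' = x \<longrightarrow> length u \<le> length u')"

definition sigma :: "nat \<Rightarrow> nat list" where
  "sigma k = [1..<Suc k]"

text \<open>
  A conormal form is kept as its list of factors \<open>[v\<^sub>n\<^sub>-\<^sub>1, \<dots>, v\<^sub>1]\<close>, each \<open>v\<^sub>k\<close> a suffix of \<open>sigma k\<close>.
\<close>

definition is_conormal_form :: "nat \<Rightarrow> (nat \<Rightarrow> nat) \<Rightarrow> nat list list \<Rightarrow> bool" where
  "is_conormal_form n x vs \<longleftrightarrow>
     list_all2 suffix vs (map sigma (rev [1..<n])) \<and> reduced_word n (concat vs) x"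

definition conormal_form :: "nat \<Rightarrow> (nat \<Rightarrow> nat) \<Rightarrow> nat list list" where
  "conormal_form n x = (THE vs. is_conormal_form n x vs)"

definition bubble_lambda :: "nat \<Rightarrow> (nat \<Rightarrow> nat) \<Rightarrow> nat list" where
  "bubble_lambda n x = map length (conormal_form n x)"

definition bubble_ge :: "nat \<Rightarrow> (nat \<Rightarrow> nat) \<Rightarrow> (nat \<Rightarrow> nat) \<Rightarrow> bool" where
  "bubble_ge n x y \<longleftrightarrow> list_all2 (\<ge>) (bubble_lambda n x) (bubble_lambda n y)"

end

theory Submission
  imports Defs
begin

text \<open>
  Both orders can be read off from inversions. For a permutation \<open>w\<close>, let \<open>lehmer w i\<close> be the number
  of positions \<open>j < i\<close> with \<open>w j > w i\<close>.

  \<^item> Peeling off the factor \<open>v\<^sub>n\<^sub>-\<^sub>1\<close> of a conormal form amounts to removing the last value of the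
    permutation and standardizing the rest. Hence \<open>|v\<^sub>k|\<close> is \<open>lehmer x (k + 1)\<close>, and the
    bubble-sorting order is the componentwise order on Lehmer codes (\<open>bubble_ge_iff_lehmer\<close>).
  \<^item> If \<open>(a, b)\<close> is an interval parking function with \<open>x = O(a)\<close>, then \<open>x\<close> is also the outcome of the
    interval procedure, so the only constraint on \<open>b\<close> is \<open>x \<le> b\<close>. As \<open>O(b*)* = y\<close> bounds \<open>b i\<close> by the
    end of the run of spots just above \<open>y i\<close> that belong to cars later than \<open>i\<close>, reachability of
    \<open>y\<close> from \<open>x\<close> means that \<open>x i < y j\<close> for every inversion \<open>j < i\<close>, \<open>y j > y i\<close> of \<open>y\<close>
    (\<open>reachable_iff_inversions\<close>).

  With this criterion, one reachability step makes the Lehmer code weakly smaller, by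
  counting the values below the smallest \<open>y j\<close> that forms an inversion with a given position
  (\<open>reachable_imp_lehmer_le\<close>). Conversely, raising one entry of the Lehmer code by \<open>1\<close> exchanges \<open>y p\<close>
  with the largest smaller value to the left of \<open>p\<close>, and such an exchange satisfies the
  criterion (\<open>lehmer_increment\<close>). Since the codes form a product of chains, any two comparable
  codes are joined by such increments.
\<close>

section \<open>Parking outcomes\<close>

text \<open>
  In this form the upper ends enter only through \<open>w \<le> b\<close>, so that relaxing them does not change
  the outcome of a procedure that succeeds.
\<close>
lemma park_eq_Some_iff:
  "park a b m = Some w \<longleftrightarrow>
     (\<forall>i\<in>{1..m}. a i \<le> w i \<and> w i \<le> b i \<and> w i \<notin> w ` {1..<i} \<and> {a i..<w i} \<subseteq> w ` {1..<i}) \<and>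
     (\<forall>i. i \<notin> {1..m} \<longrightarrow> w i = i)"
proof (induction m arbitrary: w)
  case 0
  then show ?case by (auto simp: fun_eq_iff)
next
  case (Suc m)
  let ?P = "\<lambda>w i. a i \<le> w i \<and> w i \<le> b i \<and> w i \<notin> w ` {1..<i} \<and> {a i..<w i} \<subseteq> w ` {1..<i}"
  define w0 where "w0 = w(Suc m := Suc m)"
  have same: "?P w0 i \<longleftrightarrow> ?P w i" if "i \<in> {1..m}" for i
  proof -
    have "w0 ` {1..<i} = w ` {1..<i}" "w0 i = w i"
      using that by (auto simp: w0_def)
    then show ?thesis by simp
  qed
  have img: "w0 ` {1..m} = w ` {1..<Suc m}"
    by (auto simp: w0_def)
  have "(\<forall>i\<in>{1..m}. ?P w0 i) \<and> (\<forall>i. i \<notin> {1..m} \<longrightarrow> w0 i = i) \<longleftrightarrow>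
        (\<forall>i\<in>{1..m}. ?P w i) \<and> (\<forall>i. i \<notin> {1..Suc m} \<longrightarrow> w i = i)"
    using same by (auto simp: w0_def)
  then have w0: "park a b m = Some w0 \<longleftrightarrow>
        (\<forall>i\<in>{1..m}. ?P w i) \<and> (\<forall>i. i \<notin> {1..Suc m} \<longrightarrow> w i = i)"
    using Suc.IH[of w0] by simp
  define avail where "avail = {a (Suc m)..b (Suc m)} - w0 ` {1..m}"
  have fin: "finite avail" by (simp add: avail_def)
  have min: "avail \<noteq> {} \<and> Min avail = w (Suc m) \<longleftrightarrow> ?P w (Suc m)"
  proof
    assume *: "avail \<noteq> {} \<and> Min avail = w (Suc m)"
    then have "w (Suc m) \<in> avail" using Min_in[OF fin] by metis
    moreover have "s \<in> w ` {1..<Suc m}" if "a (Suc m) \<le> s" "s < w (Suc m)" for s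
    proof (rule ccontr)
      assume "s \<notin> w ` {1..<Suc m}"
      then have "s \<in> avail"
        using that \<open>w (Suc m) \<in> avail\<close> unfolding avail_def img by auto
      then show False using Min_le[OF fin] * that by fastforce
    qed
    ultimately show "?P w (Suc m)" unfolding avail_def img by auto
  next
    assume *: "?P w (Suc m)"
    then have "w (Suc m) \<in> avail" unfolding avail_def img by auto
    moreover have "w (Suc m) \<le> s" if "s \<in> avail" for s
    proof (rule ccontr)
      assume "\<not> w (Suc m) \<le> s"
      then have "s \<in> {a (Suc m)..<w (Suc m)}" using that by (auto simp: avail_def)
      then show False using * that unfolding avail_def img by blast
    qed
    ultimately show "avail \<noteq> {} \<and> Min avail = w (Suc m)"
      using Min_eqI[OF fin] by blast
  qed
  have "park a b (Suc m) = Some w \<longleftrightarrow>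
        park a b m = Some w0 \<and> avail \<noteq> {} \<and> Min avail = w (Suc m)"
  proof
    assume "park a b (Suc m) = Some w"
    then obtain u where u: "park a b m = Some u"
      and ne: "{a (Suc m)..b (Suc m)} - u ` {1..m} \<noteq> {}"
      and w: "w = u(Suc m := Min ({a (Suc m)..b (Suc m)} - u ` {1..m}))"
      by (auto simp: Let_def split: option.splits if_splits)
    have "u (Suc m) = Suc m" using u Suc.IH[of u] by auto
    then have "u = w0" by (auto simp: w w0_def)
    then show "park a b m = Some w0 \<and> avail \<noteq> {} \<and> Min avail = w (Suc m)"
      using u ne w by (auto simp: avail_def)
  next
    assume "park a b m = Some w0 \<and> avail \<noteq> {} \<and> Min avail = w (Suc m)"
    then show "park a b (Suc m) = Some w"
      by (auto simp: avail_def w0_def Let_def)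
  qed
  also have "\<dots> \<longleftrightarrow> ((\<forall>i\<in>{1..m}. ?P w i) \<and> (\<forall>i. i \<notin> {1..Suc m} \<longrightarrow> w i = i)) \<and> ?P w (Suc m)"
    using w0 min by blast
  also have "\<dots> \<longleftrightarrow> (\<forall>i\<in>{1..Suc m}. ?P w i) \<and> (\<forall>i. i \<notin> {1..Suc m} \<longrightarrow> w i = i)"
  proof -
    have "{1..Suc m} = insert (Suc m) {1..m}" by auto
    then show ?thesis by (simp only: ball_simps) blast
  qed
  finally show ?case .
qed

lemma park_inj_on:
  assumes "park a b m = Some w"
  shows "inj_on w {1..m}"
proof (rule linorder_inj_onI')
  fix i j assume "i \<in> {1..m}" "j \<in> {1..m}" "i < j"
  then have "w j \<notin> w ` {1..<j}" "w i \<in> w ` {1..<j}"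
    using assms unfolding park_eq_Some_iff by auto
  then show "w i \<noteq> w j" by metis
qed

lemma park_permutes:
  assumes "park a b n = Some w" "a \<in> vectors n" "b \<in> vectors n"
  shows "w permutes {1..n}"
proof (rule inj_imp_permutes)
  show "inj_on w {1..n}" using assms(1) by (rule park_inj_on)
  show "finite {1..n}" by simp
  show "w i \<in> {1..n}" if "i \<in> {1..n}" for i
  proof -
    have "a i \<le> w i" "w i \<le> b i" using that assms(1) unfolding park_eq_Some_iff by blast+
    moreover have "a i \<in> {1..n}" "b i \<in> {1..n}"
      using that assms(2,3) unfolding vectors_def by blast+
    ultimately show ?thesis by simp
  qed
  show "w i = i" if "i \<notin> {1..n}" for i
    using that assms(1) unfolding park_eq_Some_iff by blast
qed

text \<open>
  If car \<open>m + 1\<close> failed, extend the occupied spots at the top end to a maximal run \<open>{t..n}\<close>. The cars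
  in this run all preferred spots \<open>\<ge> t\<close>, since none of them took the free spot \<open>t - 1\<close>; together with
  car \<open>m + 1\<close> they are too many for the injection \<open>x \<ge> c\<close> into \<open>{t..n}\<close>.
\<close>
lemma park_below_permutation:
  assumes x: "x permutes {1..n}" and c: "\<And>i. i \<in> {1..n} \<Longrightarrow> c i \<le> x i" and "m \<le> n"
  shows "park c (\<lambda>_. n) m \<noteq> None"
  using \<open>m \<le> n\<close>
proof (induction m)
  case (Suc m)
  then obtain w where w: "park c (\<lambda>_. n) m = Some w" by auto
  have "{c (Suc m)..n} - w ` {1..m} \<noteq> {}"
  proof
    assume fails: "{c (Suc m)..n} - w ` {1..m} = {}"
    define t where "t = (LEAST t. {t..n} \<subseteq> w ` {1..m})"
    have full: "{t..n} \<subseteq> w ` {1..m}"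
      unfolding t_def by (rule LeastI[of _ "c (Suc m)"]) (use fails in blast)
    have t_le: "t \<le> c (Suc m)"
      unfolding t_def by (rule Least_le) (use fails in blast)
    define J where "J = {j \<in> {1..m}. t \<le> w j}"
    have inj: "inj_on w {1..m}" using w by (rule park_inj_on)
    have "w i \<le> n" if "i \<in> {1..m}" for i
      using that w unfolding park_eq_Some_iff by auto
    then have "w ` J = {t..n}" using full by (auto simp: J_def)
    moreover have "inj_on w J" using inj by (rule inj_on_subset) (auto simp: J_def)
    ultimately have card_J: "card J = Suc n - t" by (metis card_atLeastAtMost card_image)
    have pref: "t \<le> c j" if "j \<in> J" for j
    proof (rule ccontr)
      assume less: "\<not> t \<le> c j"
      have j: "j \<in> {1..m}" "t \<le> w j" using that by (auto simp: J_def)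
      then have "{c j..<w j} \<subseteq> w ` {1..<j}" using w unfolding park_eq_Some_iff by blast
      moreover have "t - 1 \<in> {c j..<w j}" using less j by auto
      ultimately have "t - 1 \<in> w ` {1..m}" using j by fastforce
      then have "{t - 1..n} \<subseteq> w ` {1..m}"
      proof -
        have "{t - 1..n} \<subseteq> insert (t - 1) {t..n}" by auto
        then show ?thesis using full \<open>t - 1 \<in> w ` {1..m}\<close> by blast
      qed
      then have "t \<le> t - 1" unfolding t_def by (rule Least_le)
      then show False using less by auto
    qed
    have "x ` insert (Suc m) J \<subseteq> {t..n}"
    proof -
      have "x i \<in> {t..n}" if "i \<in> insert (Suc m) J" for i
      proof -
        have i: "i \<in> {1..n}" using that Suc.prems by (auto simp: J_def)
        then have "x i \<in> {1..n}" by (simp only: permutes_in_image[OF x])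
        moreover have "t \<le> c i" using that pref t_le by auto
        ultimately show ?thesis using c[OF i] by auto
      qed
      then show ?thesis by blast
    qed
    then have "card (insert (Suc m) J) \<le> card {t..n}"
      using permutes_inj_on[OF x] by (metis card_inj_on_le finite_atLeastAtMost)
    moreover have "card (insert (Suc m) J) = Suc (card J)"
      by (rule card_insert_disjoint) (auto simp: J_def)
    ultimately show False using card_J by simp
  qed
  then show ?case using w by (simp add: Let_def)
qed simp


section \<open>Reachability through inversions\<close>

lemma conjugate_apply: "i \<in> {1..n} \<Longrightarrow> conjugate n x i = n + 1 - x (n + 1 - i)"
  by (simp add: conjugate_def)

lemma reflect_mem: "(i::nat) \<in> {1..n} \<Longrightarrow> n + 1 - i \<in> {1..n}"
  by auto

lemma conjugate_permutes:
  assumes "x permutes {1..n}"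
  shows "conjugate n x permutes {1..n}"
proof (rule inj_imp_permutes)
  have x: "x i \<in> {1..n}" if "i \<in> {1..n}" for i
    using that by (simp only: permutes_in_image[OF assms])
  show "inj_on (conjugate n x) {1..n}"
  proof (rule inj_onI)
    fix i j assume ij: "i \<in> {1..n}" "j \<in> {1..n}" "conjugate n x i = conjugate n x j"
    have "x (n + 1 - i) = x (n + 1 - j)"
      using ij(3) x[OF reflect_mem[OF ij(1)]] x[OF reflect_mem[OF ij(2)]]
      unfolding conjugate_apply[OF ij(1)] conjugate_apply[OF ij(2)] atLeastAtMost_iff by linarith
    then have "n + 1 - i = n + 1 - j" using permutes_inj[OF assms] by (simp add: inj_eq)
    then show "i = j" using ij by auto
  qed
  show "conjugate n x i \<in> {1..n}" if "i \<in> {1..n}" for i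
    using x[OF reflect_mem[OF that]] unfolding conjugate_apply[OF that] atLeastAtMost_iff by linarith
qed (auto simp: conjugate_def)

lemma conjugate_conjugate:
  assumes "x permutes {1..n}"
  shows "conjugate n (conjugate n x) = x"
proof
  fix i
  show "conjugate n (conjugate n x) i = x i"
  proof (cases "i \<in> {1..n}")
    case True
    then have "x i \<in> {1..n}" by (simp only: permutes_in_image[OF assms])
    moreover have "n + 1 - (n + 1 - i) = i" using True by auto
    ultimately show ?thesis
      unfolding conjugate_apply[OF True] conjugate_apply[OF reflect_mem[OF True]] by auto
  next
    case False
    then show ?thesis using permutes_not_in[OF assms] by (auto simp: conjugate_def)
  qed
qed

lemma conjugate_vectors:
  assumes "x \<in> vectors n"
  shows "conjugate n x \<in> vectors n"
  unfolding vectors_def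
proof (rule Pi_I)
  fix i assume i: "i \<in> {1..n}"
  have "x (n + 1 - i) \<in> {1..n}"
    using assms reflect_mem[OF i] unfolding vectors_def by (rule funcset_mem)
  then show "conjugate n x i \<in> {1..n}"
    unfolding conjugate_apply[OF i] atLeastAtMost_iff by linarith
qed

lemma permutes_vectors: "x permutes {1..n} \<Longrightarrow> x \<in> vectors n"
  unfolding vectors_def by (rule Pi_I) (simp only: permutes_in_image)

lemma outcome_interval_parking:
  assumes "park a b n = Some w" "b \<in> vectors n"
  shows "outcome n a = w"
proof -
  have "w i \<le> n" if "i \<in> {1..n}" for i
  proof -
    have "w i \<le> b i" using assms(1) that unfolding park_eq_Some_iff by blast
    moreover have "b i \<in> {1..n}" using assms(2) that unfolding vectors_def by (rule funcset_mem)
    ultimately show ?thesis by simp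
  qed
  then have "park a (\<lambda>_. n) n = Some w"
    using assms(1) unfolding park_eq_Some_iff by blast
  then show ?thesis by (simp add: outcome_def)
qed

lemma reachable_permutes_inversions:
  assumes "reachable n x y"
  shows "x permutes {1..n}" "y permutes {1..n}"
    "\<And>i j. i \<in> {1..n} \<Longrightarrow> j \<in> {1..n} \<Longrightarrow> j < i \<Longrightarrow> y i < y j \<Longrightarrow> x i < y j"
proof -
  from assms obtain a b w where a: "a \<in> vectors n" and b: "b \<in> vectors n"
    and w: "park a b n = Some w" and "x = outcome n a"
    and y: "y = conjugate n (outcome n (conjugate n b))"
    unfolding reachable_def interval_parking_function_def by blast
  then have x_eq: "x = w" using outcome_interval_parking by blast
  show x: "x permutes {1..n}" unfolding x_eq using w a b by (rule park_permutes)
  define c where "c = conjugate n b"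
  have c_vec: "c \<in> vectors n" unfolding c_def using b by (rule conjugate_vectors)
  have xb: "x i \<le> b i" if "i \<in> {1..n}" for i
    using w that unfolding park_eq_Some_iff x_eq by blast
  have c_le: "c i \<le> conjugate n x i" if "i \<in> {1..n}" for i
    unfolding c_def conjugate_apply[OF that] using xb[OF reflect_mem[OF that]] by (rule diff_le_mono2)
  obtain z where z: "park c (\<lambda>_. n) n = Some z"
    using park_below_permutation[OF conjugate_permutes[OF x] c_le] by blast
  have n_vec: "(\<lambda>_. n) \<in> vectors n" by (auto simp: vectors_def)
  have z_perm: "z permutes {1..n}" using z c_vec n_vec by (rule park_permutes)
  have y_eq: "y = conjugate n z" unfolding y using z by (simp add: outcome_def c_def)
  show y_perm: "y permutes {1..n}" unfolding y_eq using z_perm by (rule conjugate_permutes)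
  fix i j assume i: "i \<in> {1..n}" and j: "j \<in> {1..n}" and "j < i" "y i < y j"
  define i' j' where "i' = n + 1 - i" and "j' = n + 1 - j"
  have i': "i' \<in> {1..n}" and j': "j' \<in> {1..n}"
    unfolding i'_def j'_def using i j by auto
  have "i' < j'" using i j \<open>j < i\<close> by (auto simp: i'_def j'_def)
  have z_mem: "z i' \<in> {1..n}" "z j' \<in> {1..n}"
    using i' j' by (simp_all only: permutes_in_image[OF z_perm])
  have yi: "y i = n + 1 - z i'" and yj: "y j = n + 1 - z j'"
    unfolding y_eq i'_def j'_def by (simp_all add: conjugate_apply[OF i] conjugate_apply[OF j])
  have less: "z j' < z i'" using \<open>y i < y j\<close> z_mem unfolding yi yj by auto
  have "\<not> c i' \<le> z j'"
  proof
    assume "c i' \<le> z j'"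
    then have "z j' \<in> z ` {1..<i'}"
      using z i' less unfolding park_eq_Some_iff by (metis atLeastLessThan_iff subsetD)
    then have "j' \<in> {1..<i'}" using permutes_inj[OF z_perm] by (auto simp: inj_eq)
    then show False using \<open>i' < j'\<close> by simp
  qed
  moreover have "n + 1 - i' = i" using i by (auto simp: i'_def)
  then have "conjugate n x i' = n + 1 - x i" using conjugate_apply[OF i'] by metis
  moreover have "x i \<in> {1..n}" using i by (simp only: permutes_in_image[OF x])
  ultimately show "x i < y j" using c_le[OF i'] z_mem unfolding yj by auto
qed

text \<open>
  For the converse, the smallest admissible choice of \<open>b\<close> is the pointwise maximum of \<open>x\<close> and \<open>y\<close>,
  and \<open>a = x\<close> will do because cars that prefer distinct spots park where they want.
\<close>
lemma reachableI:
  assumes x: "x permutes {1..n}" and y: "y permutes {1..n}"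
    and inversion: "\<And>i j. i \<in> {1..n} \<Longrightarrow> j \<in> {1..n} \<Longrightarrow> j < i \<Longrightarrow> y i < y j \<Longrightarrow> x i < y j"
  shows "reachable n x y"
proof -
  \<comment> \<open>Then \<open>c\<close> is the pointwise minimum of the conjugates, and the inversion hypothesis says that the
    spots from \<open>c i\<close> up to \<open>z i - 1\<close> belong to cars before \<open>i\<close>.\<close>
  define b where "b = (\<lambda>i. max (x i) (y i))"
  define c where "c = conjugate n b"
  define z where "z = conjugate n y"
  have z_perm: "z permutes {1..n}" unfolding z_def using y by (rule conjugate_permutes)
  have b_vec: "b \<in> vectors n"
    using permutes_vectors[OF x] permutes_vectors[OF y] unfolding vectors_def b_def Pi_iff
    by (metis max_def)
  have x_fresh: "x i \<notin> x ` {1..<i}" for i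
    using permutes_inj[OF x] by (auto simp: inj_eq)
  have px: "park x b n = Some x"
    unfolding park_eq_Some_iff b_def using x_fresh permutes_not_in[OF x] by auto
  have "{c i..<z i} \<subseteq> z ` {1..<i}" if i: "i \<in> {1..n}" for i
  proof
    fix s assume s: "s \<in> {c i..<z i}"
    define i' where "i' = n + 1 - i"
    have i': "i' \<in> {1..n}" unfolding i'_def using i by auto
    have mem: "x i' \<in> {1..n}" "y i' \<in> {1..n}"
      using i' by (simp_all only: permutes_in_image[OF x] permutes_in_image[OF y])
    have ci: "c i = n + 1 - b i'" and zi: "z i = n + 1 - y i'"
      unfolding c_def z_def i'_def by (simp_all add: conjugate_apply[OF i])
    have "s \<in> {1..n}" using s mem unfolding ci zi b_def by auto
    then obtain j where j: "j \<in> {1..n}" "z j = s"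
      using permutes_image[OF z_perm] by (metis imageE)
    define j' where "j' = n + 1 - j"
    have j': "j' \<in> {1..n}" unfolding j'_def using j by auto
    have mem_j: "y j' \<in> {1..n}" using j' by (simp only: permutes_in_image[OF y])
    have zj: "s = n + 1 - y j'"
      using j unfolding z_def j'_def by (simp add: conjugate_apply)
    have "y i' < y j'" "y j' \<le> x i'"
      using s mem mem_j unfolding ci zi zj b_def by auto
    then have "\<not> j' < i'" using inversion[OF i' j'] by auto
    then have "j \<le> i" using i j by (auto simp: i'_def j'_def)
    moreover have "j \<noteq> i" using j s by auto
    ultimately show "s \<in> z ` {1..<i}" using j by auto
  qed
  moreover have "c i \<le> z i" if "i \<in> {1..n}" for i
    unfolding c_def z_def b_def conjugate_apply[OF that] by (rule diff_le_mono2) simp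
  moreover have "z i \<notin> z ` {1..<i}" for i
    using permutes_inj[OF z_perm] by (auto simp: inj_eq)
  moreover have "z i \<le> n" if "i \<in> {1..n}" for i
    using that permutes_in_image[OF z_perm] by fastforce
  ultimately have pz: "park c (\<lambda>_. n) n = Some z"
    unfolding park_eq_Some_iff using permutes_not_in[OF z_perm] by blast
  have "interval_parking_function n x b"
    unfolding interval_parking_function_def using permutes_vectors[OF x] b_vec px
    by (simp add: b_def)
  moreover have "x = outcome n x" using outcome_interval_parking[OF px b_vec] by simp
  moreover have "y = conjugate n (outcome n (conjugate n b))"
    using pz conjugate_conjugate[OF y] by (simp add: outcome_def c_def z_def)
  ultimately show ?thesis unfolding reachable_def by blast
qed

text \<open>
  The spots that a car \<open>i\<close> passes between \<open>y i\<close> and \<open>b i\<close> in the reversed process must hold later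
  cars. Hence, when \<open>j < i\<close> and \<open>y j > y i\<close>, the interval of car \<open>i\<close> ends before \<open>y j\<close>; and it
  contains \<open>x i\<close>.
\<close>
lemma reachable_iff_inversions:
  "reachable n x y \<longleftrightarrow>
     x permutes {1..n} \<and> y permutes {1..n} \<and>
     (\<forall>i\<in>{1..n}. \<forall>j\<in>{1..n}. j < i \<and> y i < y j \<longrightarrow> x i < y j)"
  using reachable_permutes_inversions reachableI by metis


section \<open>The Lehmer code of a conormal form\<close>

definition lehmer :: "(nat \<Rightarrow> nat) \<Rightarrow> nat \<Rightarrow> nat" where
  "lehmer w i = card {j \<in> {1..<i}. w i < w j}"

definition inversions :: "nat \<Rightarrow> (nat \<Rightarrow> nat) \<Rightarrow> (nat \<times> nat) set" where
  "inversions n w = (SIGMA i:{1..n}. {j \<in> {1..<i}. w i < w j})"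

lemma card_inversions: "card (inversions n w) = (\<Sum>i\<in>{1..n}. lehmer w i)"
  unfolding inversions_def lehmer_def by (rule card_SigmaI) auto

lemma word_perm_Nil [simp]: "word_perm [] = id"
  and word_perm_Cons [simp]: "word_perm (i # u) = transpose i (Suc i) \<circ> word_perm u"
  by (simp_all add: word_perm_def)

lemma word_perm_append: "word_perm (u @ v) = word_perm u \<circ> word_perm v"
  by (induction u) (simp_all add: o_assoc)

lemma inj_word_perm: "inj (word_perm u)"
proof (induction u)
  case (Cons i u)
  then show ?case unfolding word_perm_Cons by (intro inj_compose inj_transpose)
qed simp

text \<open>
  Composing with \<open>s\<^sub>i\<close> on the left only affects the relative order of the two positions that hold
  the values \<open>i\<close> and \<open>i + 1\<close>, so each letter contributes at most one inversion.
\<close>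
lemma card_inversions_word_perm: "card (inversions n (word_perm u)) \<le> length u"
proof (induction u)
  case Nil
  have "inversions n (word_perm []) = {}" by (auto simp: inversions_def)
  then show ?case by (metis card.empty le0)
next
  case (Cons i u)
  let ?w = "word_perm u"
  have fin: "finite (inversions n ?w)" by (auto simp: inversions_def)
  have "inversions n (word_perm (i # u)) \<subseteq>
          insert (the_inv ?w (Suc i), the_inv ?w i) (inversions n ?w)"
  proof
    fix e assume "e \<in> inversions n (word_perm (i # u))"
    then obtain k j where e: "e = (k, j)" and kj: "k \<in> {1..n}" "j \<in> {1..<k}"
      and less: "transpose i (Suc i) (?w k) < transpose i (Suc i) (?w j)"
      by (auto simp: inversions_def)
    have "?w k \<noteq> ?w j" using kj inj_word_perm[of u] by (auto simp: inj_eq)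
    then consider "?w k < ?w j" | "?w j = i" "?w k = Suc i"
      using less by (auto simp: transpose_def split: if_splits)
    then show "e \<in> insert (the_inv ?w (Suc i), the_inv ?w i) (inversions n ?w)"
    proof cases
      case 1
      then show ?thesis using e kj by (auto simp: inversions_def)
    next
      case 2
      then have "the_inv ?w i = j" "the_inv ?w (Suc i) = k"
        using the_inv_f_f[OF inj_word_perm[of u], of j] the_inv_f_f[OF inj_word_perm[of u], of k]
        by simp_all
      then show ?thesis using e by simp
    qed
  qed
  then have "card (inversions n (word_perm (i # u))) \<le>
      card (insert (the_inv ?w (Suc i), the_inv ?w i) (inversions n ?w))"
    using fin by (intro card_mono) auto
  also have "\<dots> \<le> Suc (card (inversions n ?w))" using fin by (simp add: card_insert_if)
  finally show ?case using Cons.IH unfolding list.size by linarith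
qed

lemma word_perm_upt:
  assumes "j \<le> Suc m"
  shows "word_perm [j..<Suc m] =
    (\<lambda>i. if i = Suc m then j else if j \<le> i \<and> i \<le> m then Suc i else i)"
  using assms
proof (induction rule: inc_induct)
  case base
  then show ?case by (auto simp: fun_eq_iff)
next
  case (step j)
  then have "[j..<Suc m] = j # [Suc j..<Suc m]" by (simp add: upt_conv_Cons)
  then show ?case using step by (auto simp: fun_eq_iff transpose_def)
qed

lemma word_perm_upt_permutes:
  assumes "1 \<le> j" "j \<le> Suc m"
  shows "word_perm [j..<Suc m] permutes {1..Suc m}"
  unfolding word_perm_upt[OF assms(2)]
  by (rule inj_imp_permutes) (use assms in \<open>auto simp: inj_on_def split: if_splits\<close>)

text \<open>
  The cycle \<open>s\<^sub>j\<dots>s\<^sub>m\<close> sends \<open>m + 1\<close> to \<open>j\<close> and is increasing on \<open>{1..m}\<close>: it inserts the value \<open>j\<close> at the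
  last position and keeps the relative order of the others.
\<close>
lemma lehmer_insert_last:
  assumes w: "w permutes {1..m}" and j: "1 \<le> j" "j \<le> Suc m"
  shows "word_perm [j..<Suc m] \<circ> w permutes {1..Suc m}"
    and "lehmer (word_perm [j..<Suc m] \<circ> w) (Suc m) = Suc m - j"
    and "i \<le> m \<Longrightarrow> lehmer (word_perm [j..<Suc m] \<circ> w) i = lehmer w i"
proof -
  let ?c = "word_perm [j..<Suc m]"
  note c = word_perm_upt[OF j(2)]
  have w_mem: "w i \<in> {1..m}" if "i \<in> {1..m}" for i
    using that by (simp only: permutes_in_image[OF w])
  have w_last: "w (Suc m) = Suc m" using permutes_not_in[OF w] by simp
  show "?c \<circ> w permutes {1..Suc m}"
    by (rule permutes_compose[OF permutes_subset[OF w] word_perm_upt_permutes[OF j]]) auto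
  have "(?c \<circ> w) (Suc m) < (?c \<circ> w) i \<longleftrightarrow> w i \<in> {j..m}" if "i \<in> {1..m}" for i
    using w_mem[OF that] w_last unfolding c o_apply by auto
  then have "{i \<in> {1..<Suc m}. (?c \<circ> w) (Suc m) < (?c \<circ> w) i} = {i \<in> {1..m}. w i \<in> {j..m}}"
    by auto
  moreover have "w ` {i \<in> {1..m}. w i \<in> {j..m}} = {j..m}"
  proof -
    have "s \<in> w ` {i \<in> {1..m}. w i \<in> {j..m}}" if "s \<in> {j..m}" for s
    proof -
      have "s \<in> w ` {1..m}" using that j permutes_image[OF w] by auto
      then show ?thesis using that by auto
    qed
    then show ?thesis by auto
  qed
  then have "card {i \<in> {1..m}. w i \<in> {j..m}} = Suc m - j"
    using card_image[OF permutes_inj_on[OF w]] by (metis card_atLeastAtMost)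
  ultimately show "lehmer (?c \<circ> w) (Suc m) = Suc m - j"
    by (simp add: lehmer_def)
  assume "i \<le> m"
  have "(?c \<circ> w) i < (?c \<circ> w) k \<longleftrightarrow> w i < w k" if "k \<in> {1..<i}" for k
  proof -
    have "i \<in> {1..m}" "k \<in> {1..m}" using that \<open>i \<le> m\<close> by auto
    then have "w i \<in> {1..m}" "w k \<in> {1..m}" using w_mem by blast+
    then show ?thesis unfolding c o_apply by auto
  qed
  then have "{k \<in> {1..<i}. (?c \<circ> w) i < (?c \<circ> w) k} = {k \<in> {1..<i}. w i < w k}" by blast
  then show "lehmer (?c \<circ> w) i = lehmer w i" by (simp add: lehmer_def)
qed

lemma suffix_sigma_iff: "suffix v (sigma k) \<longleftrightarrow> (\<exists>j. 1 \<le> j \<and> j \<le> Suc k \<and> v = [j..<Suc k])"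
proof
  assume "suffix v (sigma k)"
  then obtain us where us: "sigma k = us @ v" by (auto simp: suffix_def)
  then have "v = drop (length us) (sigma k)" by simp
  then have "v = [1 + length us..<Suc k]" by (simp add: sigma_def drop_upt del: upt_Suc)
  moreover have "length us \<le> k" using arg_cong[OF us, of length] by (simp add: sigma_def del: upt_Suc)
  ultimately show "\<exists>j. 1 \<le> j \<and> j \<le> Suc k \<and> v = [j..<Suc k]"
    by (intro exI[of _ "1 + length us"]) simp
next
  assume "\<exists>j. 1 \<le> j \<and> j \<le> Suc k \<and> v = [j..<Suc k]"
  then obtain j where j: "1 \<le> j" "j \<le> Suc k" "v = [j..<Suc k]" by blast
  have "[1..<j + (Suc k - j)] = [1..<j] @ [j..<j + (Suc k - j)]"
    using j(1) by (rule upt_add_eq_append)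
  then have "sigma k = [1..<j] @ v"
    using j by (simp add: sigma_def del: upt_Suc)
  then show "suffix v (sigma k)" by (auto simp: suffix_def)
qed

lemma lehmer_concat_suffixes:
  assumes "list_all2 suffix vs (map sigma (rev [1..<Suc m]))"
  shows "word_perm (concat vs) permutes {1..Suc m} \<and>
         map length vs = map (\<lambda>k. lehmer (word_perm (concat vs)) (Suc k)) (rev [1..<Suc m])"
  using assms
proof (induction m arbitrary: vs)
  case 0
  then show ?case by (simp add: id_def)
next
  case (Suc m)
  have rev: "rev [1..<Suc (Suc m)] = Suc m # rev [1..<Suc m]" by simp
  from Suc.prems obtain v us where vs: "vs = v # us" and v: "suffix v (sigma (Suc m))"
    and us: "list_all2 suffix us (map sigma (rev [1..<Suc m]))"
    unfolding rev by (auto simp: list_all2_Cons2)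
  from v obtain j where j: "1 \<le> j" "j \<le> Suc (Suc m)" and v_eq: "v = [j..<Suc (Suc m)]"
    unfolding suffix_sigma_iff by blast
  let ?w = "word_perm (concat us)"
  have w: "?w permutes {1..Suc m}" using Suc.IH[OF us] by blast
  have lens: "map length us = map (\<lambda>k. lehmer ?w (Suc k)) (rev [1..<Suc m])"
    using Suc.IH[OF us] by blast
  have x: "word_perm (concat vs) = word_perm [j..<Suc (Suc m)] \<circ> ?w"
    unfolding vs v_eq concat.simps word_perm_append ..
  show ?case
  proof
    show "word_perm (concat vs) permutes {1..Suc (Suc m)}"
      unfolding x by (rule lehmer_insert_last(1)[OF w j])
    have "lehmer (word_perm (concat vs)) (Suc (Suc m)) = length v"
      unfolding x lehmer_insert_last(2)[OF w j] by (simp add: v_eq del: upt_Suc)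
    moreover have "map (\<lambda>k. lehmer (word_perm (concat vs)) (Suc k)) (rev [1..<Suc m]) =
        map (\<lambda>k. lehmer ?w (Suc k)) (rev [1..<Suc m])"
      unfolding x by (rule map_cong[OF refl]) (auto intro: lehmer_insert_last(3)[OF w j] simp del: upt_Suc)
    ultimately show "map length vs =
        map (\<lambda>k. lehmer (word_perm (concat vs)) (Suc k)) (rev [1..<Suc (Suc m)])"
      unfolding rev by (simp add: lens vs del: upt_Suc)
  qed
qed

lemma exists_concat_suffixes:
  assumes "x permutes {1..Suc m}"
  shows "\<exists>vs. list_all2 suffix vs (map sigma (rev [1..<Suc m])) \<and> word_perm (concat vs) = x"
  using assms
proof (induction m arbitrary: x)
  case 0
  then have "x = id" by simp
  then show ?case by (intro exI[of _ "[]"]) simp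
next
  case (Suc m)
  let ?N = "Suc (Suc m)"
  define j where "j = x ?N"
  have "j \<in> {1..?N}" unfolding j_def by (simp only: permutes_in_image[OF Suc.prems]) simp
  then have j: "1 \<le> j" "j \<le> ?N" by auto
  let ?c = "word_perm [j..<?N]"
  have c: "?c permutes {1..?N}" using word_perm_upt_permutes[OF j] .
  define w where "w = inv ?c \<circ> x"
  have w_N: "w permutes {1..?N}"
    unfolding w_def by (rule permutes_compose[OF Suc.prems permutes_inv[OF c]])
  have "?c ?N = j" by (simp add: word_perm_upt[OF j(2)] del: upt_Suc)
  then have "w ?N = ?N" using permutes_inv_eq[OF c] by (simp add: w_def j_def del: upt_Suc)
  then have "w permutes {1..Suc m}"
    using w_N by (intro permutes_superset[OF w_N]) (auto simp: le_Suc_eq)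
  then obtain us where us: "list_all2 suffix us (map sigma (rev [1..<Suc m]))"
    and w: "word_perm (concat us) = w" using Suc.IH by blast
  have "word_perm (concat ([j..<?N] # us)) = ?c \<circ> w"
    unfolding concat.simps word_perm_append w ..
  also have "\<dots> = x" unfolding w_def o_assoc permutes_inv_o(1)[OF c] by simp
  finally have x: "word_perm (concat ([j..<?N] # us)) = x" .
  have rev: "rev [1..<?N] = Suc m # rev [1..<Suc m]" by simp
  have "suffix [j..<?N] (sigma (Suc m))" unfolding suffix_sigma_iff using j by blast
  then have "list_all2 suffix ([j..<?N] # us) (map sigma (rev [1..<?N]))"
    unfolding rev using us by simp
  then show ?case using x by blast
qed

lemma suffixes_eqI:
  assumes "list_all2 suffix us ws" "list_all2 suffix vs ws" "map length us = map length vs"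
  shows "us = vs"
  using assms
proof (induction arbitrary: vs rule: list_all2_induct)
  case (Cons u us w ws)
  then show ?case
    by (auto simp: list_all2_Cons2 suffix_def)
qed simp

lemma lehmer_first: "lehmer w (Suc 0) = 0"
  by (simp add: lehmer_def)

text \<open>
  A concatenation of suffixes is reduced because its length equals the number of inversions, which
  is a lower bound for every word. It is unique because the Lehmer code of the permutation
  determines the length of each factor.
\<close>
lemma conormal_form_unique:
  assumes "x permutes {1..Suc m}"
  shows "\<exists>!vs. is_conormal_form (Suc m) x vs"
proof (rule ex_ex1I)
  obtain vs where vs: "list_all2 suffix vs (map sigma (rev [1..<Suc m]))"
    and x: "word_perm (concat vs) = x"
    using exists_concat_suffixes[OF assms] by blast
  have lens: "map length vs = map (\<lambda>k. lehmer x (Suc k)) (rev [1..<Suc m])"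
    using lehmer_concat_suffixes[OF vs] x by simp
  have "length (concat vs) = sum_list (map length vs)" by (simp add: length_concat)
  also have "\<dots> = sum_list (map (\<lambda>k. lehmer x (Suc k)) [1..<Suc m])"
    unfolding lens by (metis rev_map sum_list_rev)
  also have "\<dots> = (\<Sum>k\<in>{1..<Suc m}. lehmer x (Suc k))"
    by (simp add: interv_sum_list_conv_sum_set_nat del: upt_Suc)
  also have "\<dots> = (\<Sum>i\<in>{Suc 1..<Suc (Suc m)}. lehmer x i)"
    by (rule sum.shift_bounds_Suc_ivl[symmetric])
  also have "\<dots> = (\<Sum>i\<in>{1..Suc m}. lehmer x i)"
    by (rule sum.mono_neutral_left) (auto simp: lehmer_first le_Suc_eq not_less_eq_eq)
  also have "\<dots> = card (inversions (Suc m) x)" by (simp add: card_inversions)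
  finally have len: "length (concat vs) = card (inversions (Suc m) x)" .
  have "reduced_word (Suc m) (concat vs) x"
    unfolding reduced_word_def
  proof (intro conjI allI impI)
    show "set (concat vs) \<subseteq> {1..<Suc m}"
    proof
      fix i assume "i \<in> set (concat vs)"
      then obtain v where "v \<in> set vs" "i \<in> set v" by auto
      then obtain l where l: "l < length vs" "v = vs ! l" by (metis in_set_conv_nth)
      let ?ws = "map sigma (rev [1..<Suc m])"
      have "suffix v (?ws ! l)" unfolding l(2) using vs l(1) by (rule list_all2_nthD)
      moreover have "?ws ! l \<in> set ?ws" using l(1) list_all2_lengthD[OF vs] by (metis nth_mem)
      ultimately obtain k where "k \<in> {1..<Suc m}" "suffix v (sigma k)"
        by (auto simp del: upt_Suc)
      then show "i \<in> {1..<Suc m}"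
        using set_mono_suffix[of v "sigma k"] \<open>i \<in> set v\<close> by (auto simp: sigma_def)
    qed
    show "word_perm (concat vs) = x" by (rule x)
    show "length (concat vs) \<le> length u'" if "set u' \<subseteq> {1..<Suc m} \<and> word_perm u' = x" for u'
      using that card_inversions_word_perm[of "Suc m" u'] len by simp
  qed
  then show "\<exists>vs. is_conormal_form (Suc m) x vs"
    using vs unfolding is_conormal_form_def by blast
next
  fix us vs assume "is_conormal_form (Suc m) x us" "is_conormal_form (Suc m) x vs"
  then show "us = vs"
    unfolding is_conormal_form_def reduced_word_def
    using lehmer_concat_suffixes suffixes_eqI by metis
qed

lemma bubble_lambda_conormal:
  assumes "x permutes {1..Suc m}"
  shows "bubble_lambda (Suc m) x = map (\<lambda>k. lehmer x (Suc k)) (rev [1..<Suc m])"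
proof -
  have "is_conormal_form (Suc m) x (conormal_form (Suc m) x)"
    unfolding conormal_form_def by (rule theI'[OF conormal_form_unique[OF assms]])
  then show ?thesis
    unfolding bubble_lambda_def is_conormal_form_def reduced_word_def
    using lehmer_concat_suffixes by metis
qed

lemma list_all2_map_same: "list_all2 P (map f xs) (map g xs) \<longleftrightarrow> (\<forall>k\<in>set xs. P (f k) (g k))"
  by (induction xs) auto

lemma bubble_ge_iff_lehmer:
  assumes "x permutes {1..n}" "y permutes {1..n}" "n \<ge> 1"
  shows "bubble_ge n x y \<longleftrightarrow> (\<forall>i\<in>{1..n}. lehmer y i \<le> lehmer x i)"
proof -
  obtain m where n: "n = Suc m" using \<open>n \<ge> 1\<close> by (cases n) auto
  have "bubble_ge n x y \<longleftrightarrow> (\<forall>k\<in>{1..<Suc m}. lehmer y (Suc k) \<le> lehmer x (Suc k))"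
    using assms unfolding n bubble_ge_def
    by (simp add: bubble_lambda_conormal list_all2_map_same del: upt_Suc)
  also have "\<dots> \<longleftrightarrow> (\<forall>i\<in>{1..n}. lehmer y i \<le> lehmer x i)"
  proof
    assume *: "\<forall>k\<in>{1..<Suc m}. lehmer y (Suc k) \<le> lehmer x (Suc k)"
    show "\<forall>i\<in>{1..n}. lehmer y i \<le> lehmer x i"
    proof
      fix i assume "i \<in> {1..n}"
      then obtain k where "i = Suc k" "k \<le> m" unfolding n by (cases i) auto
      then show "lehmer y i \<le> lehmer x i"
        using * by (cases "k = 0") (auto simp: lehmer_first)
    qed
  qed (auto simp: n)
  finally show ?thesis .
qed

text \<open>Equal codes yield the same suffixes, hence the same word.\<close>
lemma lehmer_inject:
  assumes "x permutes {1..n}" "y permutes {1..n}" "\<And>i. i \<in> {1..n} \<Longrightarrow> lehmer x i = lehmer y i"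
  shows "x = y"
proof (cases n)
  case 0
  then show ?thesis using assms by simp
next
  case (Suc m)
  have x: "x permutes {1..Suc m}" and y: "y permutes {1..Suc m}" using assms Suc by auto
  obtain us where us: "list_all2 suffix us (map sigma (rev [1..<Suc m]))" "word_perm (concat us) = x"
    using exists_concat_suffixes[OF x] by blast
  obtain vs where vs: "list_all2 suffix vs (map sigma (rev [1..<Suc m]))" "word_perm (concat vs) = y"
    using exists_concat_suffixes[OF y] by blast
  have "map (\<lambda>k. lehmer x (Suc k)) (rev [1..<Suc m]) = map (\<lambda>k. lehmer y (Suc k)) (rev [1..<Suc m])"
    by (rule map_cong[OF refl]) (auto intro: assms(3) simp: Suc)
  then have "map length us = map length vs"
    using lehmer_concat_suffixes[OF us(1)] lehmer_concat_suffixes[OF vs(1)] us(2) vs(2) by simp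
  then have "us = vs" by (rule suffixes_eqI[OF us(1) vs(1)])
  then show ?thesis using us vs by simp
qed


section \<open>Comparing the two orders\<close>

text \<open>
  Let \<open>t\<close> be the smallest value larger than \<open>y p\<close> to the left of \<open>p\<close>. Every position \<open>i \<ge> p\<close> with
  \<open>y i < t\<close> forms an inversion with the position of \<open>t\<close>, so that \<open>x i < t\<close>. Thus at least as many of the
  values below \<open>t\<close> lie at positions \<open>\<ge> p\<close> in \<open>x\<close> as in \<open>y\<close>, and at most as many lie before \<open>p\<close>.
\<close>
lemma reachable_imp_lehmer_le:
  assumes "reachable n x y" and p: "p \<in> {1..n}"
  shows "lehmer y p \<le> lehmer x p"
proof (cases "{j \<in> {1..<p}. y p < y j} = {}")
  case True
  then show ?thesis unfolding lehmer_def True by simp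
next
  case False
  have x: "x permutes {1..n}" and y: "y permutes {1..n}"
    and inversion: "\<And>i j. i \<in> {1..n} \<Longrightarrow> j \<in> {1..n} \<Longrightarrow> j < i \<Longrightarrow> y i < y j \<Longrightarrow> x i < y j"
    using assms(1) unfolding reachable_iff_inversions by blast+
  define V where "V = y ` {j \<in> {1..<p}. y p < y j}"
  define t where "t = Min V"
  have fin: "finite V" by (simp add: V_def)
  have "t \<in> V" unfolding t_def using fin False by (intro Min_in) (auto simp: V_def)
  then obtain q where q: "q \<in> {1..<p}" "y p < y q" "t = y q" by (auto simp: V_def)
  have t_min: "t \<le> y j" if "j \<in> {1..<p}" "y p < y j" for j
    unfolding t_def using fin that by (intro Min_le) (auto simp: V_def)
  have x_less: "x i < t" if "i \<in> {p..n}" "y i < t" for i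
    using inversion[of i q] that p q by auto
  let ?before = "\<lambda>w. {i \<in> {1..<p}. w i < t}" and ?after = "\<lambda>w. {i \<in> {p..n}. w i < t}"
  have total: "card (?before w) + card (?after w) = card {1..<t}" if "w permutes {1..n}" for w
  proof -
    have t: "t \<le> n" using q p permutes_in_image[OF y, of q] by auto
    have "w ` (?before w \<union> ?after w) = {1..<t}"
    proof
      show "w ` (?before w \<union> ?after w) \<subseteq> {1..<t}"
      proof
        fix s assume "s \<in> w ` (?before w \<union> ?after w)"
        then obtain i where i: "s = w i" "i \<in> {1..n}" "w i < t" using p by auto
        moreover have "w i \<in> {1..n}" using i(2) by (simp only: permutes_in_image[OF that])
        ultimately show "s \<in> {1..<t}" by auto
      qed
      show "{1..<t} \<subseteq> w ` (?before w \<union> ?after w)"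
      proof
        fix s assume s: "s \<in> {1..<t}"
        then have "s \<in> w ` {1..n}" using t permutes_image[OF that] by auto
        then obtain i where "i \<in> {1..n}" "s = w i" by blast
        then show "s \<in> w ` (?before w \<union> ?after w)" using s by fastforce
      qed
    qed
    moreover have "card (w ` (?before w \<union> ?after w)) = card (?before w \<union> ?after w)"
      by (rule card_image[OF permutes_inj_on[OF that]])
    moreover have "card (?before w \<union> ?after w) = card (?before w) + card (?after w)"
      by (rule card_Un_disjoint) auto
    ultimately show ?thesis by simp
  qed
  have "card (?after y) \<le> card (?after x)" using x_less by (intro card_mono) auto
  then have before: "card (?before x) \<le> card (?before y)" using total[OF x] total[OF y] by linarith
  have split: "card {1..<p} = card (?before w) + card {i \<in> {1..<p}. t \<le> w i}" for w :: "nat \<Rightarrow> nat"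
  proof -
    have "{1..<p} = ?before w \<union> {i \<in> {1..<p}. t \<le> w i}" by auto
    moreover have "card (?before w \<union> {i \<in> {1..<p}. t \<le> w i}) =
        card (?before w) + card {i \<in> {1..<p}. t \<le> w i}"
      by (rule card_Un_disjoint) auto
    ultimately show ?thesis by metis
  qed
  have "{j \<in> {1..<p}. y p < y j} = {i \<in> {1..<p}. t \<le> y i}"
    using t_min q by auto
  then have "lehmer y p = card {i \<in> {1..<p}. t \<le> y i}" by (simp add: lehmer_def)
  also have "\<dots> \<le> card {i \<in> {1..<p}. t \<le> x i}" using before split[of x] split[of y] by linarith
  also have "\<dots> \<le> lehmer x p"
    unfolding lehmer_def using x_less[of p] p q by (intro card_mono) auto
  finally show ?thesis .
qed

text \<open>
  Exchanging \<open>y p\<close> with the largest smaller value \<open>y q\<close> to its left raises the code at \<open>p\<close> only: no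
  value at a position before \<open>p\<close> lies between \<open>y q\<close> and \<open>y p\<close>. For the same reason, the
  only entry that grows, at position \<open>q\<close>, stays below every \<open>y j\<close> that forms an inversion with it.
\<close>
lemma lehmer_increment:
  assumes y: "y permutes {1..n}" and p: "p \<in> {1..n}" and less: "lehmer y p < p - 1"
  obtains z where "reachable n z y" "z permutes {1..n}" "lehmer z p = Suc (lehmer y p)"
    "\<And>i. i \<in> {1..n} \<Longrightarrow> i \<noteq> p \<Longrightarrow> lehmer z i = lehmer y i"
proof -
  have inj: "y i = y j \<longleftrightarrow> i = j" for i j using permutes_inj[OF y] by (simp add: inj_eq)
  let ?S = "{j \<in> {1..<p}. y j < y p}"
  have "?S \<noteq> {}"
  proof
    assume "?S = {}"
    have "y p < y j" if "j \<in> {1..<p}" for j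
    proof -
      have "\<not> y j < y p" using \<open>?S = {}\<close> that by blast
      moreover have "y j \<noteq> y p" unfolding inj using that by simp
      ultimately show ?thesis by simp
    qed
    then have "{j \<in> {1..<p}. y p < y j} = {1..<p}" by blast
    then show False using less by (simp add: lehmer_def)
  qed
  then have "Max (y ` ?S) \<in> y ` ?S" by (intro Max_in) auto
  then obtain q where q: "q \<in> {1..<p}" "y q < y p" "y q = Max (y ` ?S)" by auto
  have gap: "y j \<le> y q \<or> y p \<le> y j" if "1 \<le> j" "j < p" for j
  proof (cases "y j < y p")
    case True
    then have "y j \<in> y ` ?S" using that by auto
    then show ?thesis unfolding q(3) by simp
  qed simp
  have qn: "q \<in> {1..n}" using q p by auto
  define z where "z = y \<circ> transpose p q"
  have z_perm: "z permutes {1..n}"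
    unfolding z_def by (rule permutes_compose[OF permutes_swap_id[OF p qn] y])
  have zp: "z p = y q" and zq: "z q = y p" and z_other: "\<And>i. i \<noteq> p \<Longrightarrow> i \<noteq> q \<Longrightarrow> z i = y i"
    by (auto simp: z_def transpose_def)
  have "reachable n z y"
  proof (rule reachableI[OF z_perm y])
    fix i j assume ij: "i \<in> {1..n}" "j \<in> {1..n}" "j < i" "y i < y j"
    consider "i = p" | "i = q" | "i \<noteq> p" "i \<noteq> q" by blast
    then show "z i < y j"
    proof cases
      case 1
      then show ?thesis using ij zp q by simp
    next
      case 2
      then have "y p \<le> y j" using gap[of j] ij q by auto
      moreover have "y p \<noteq> y j" unfolding inj using 2 ij q by auto
      ultimately show ?thesis using 2 zq by simp
    next
      case 3
      then show ?thesis using ij z_other by simp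
    qed
  qed
  moreover have "lehmer z p = Suc (lehmer y p)"
  proof -
    have "{j \<in> {1..<p}. z p < z j} = insert q {j \<in> {1..<p}. y p < y j}"
    proof (intro set_eqI)
      fix j
      show "j \<in> {j \<in> {1..<p}. z p < z j} \<longleftrightarrow> j \<in> insert q {j \<in> {1..<p}. y p < y j}"
        using gap[of j] q inj[of j p] zp zq z_other[of j] by (cases "j = q") auto
    qed
    moreover have "q \<notin> {j \<in> {1..<p}. y p < y j}" using q by simp
    ultimately show ?thesis by (simp add: lehmer_def)
  qed
  moreover have "lehmer z i = lehmer y i" if i: "i \<in> {1..n}" "i \<noteq> p" for i
  proof (cases "p < i")
    case True
    have "{j \<in> {1..<i}. z i < z j} = transpose p q ` {j \<in> {1..<i}. y i < y j}"
    proof (intro set_eqI)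
      fix j
      have "transpose p q j \<in> {1..<i} \<longleftrightarrow> j \<in> {1..<i}"
        using True p q by (auto simp: transpose_def)
      moreover have "j \<in> transpose p q ` A \<longleftrightarrow> transpose p q j \<in> A" for A
        by (metis image_iff transpose_involutory)
      moreover have "z i = y i" using True q by (intro z_other) auto
      ultimately show "j \<in> {j \<in> {1..<i}. z i < z j} \<longleftrightarrow> j \<in> transpose p q ` {j \<in> {1..<i}. y i < y j}"
        by (simp add: z_def) blast
    qed
    then show ?thesis unfolding lehmer_def by (simp add: card_image inj_on_subset[OF inj_transpose])
  next
    case False
    then have "i < p" using i by simp
    have "z i < z j \<longleftrightarrow> y i < y j" if j: "j \<in> {1..<i}" for j
    proof -
      have "y j \<noteq> y p" "y i \<noteq> y p" unfolding inj using j \<open>i < p\<close> by auto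
      then show ?thesis
        using gap[of i] gap[of j] inj[of i q] inj[of j q] j \<open>i < p\<close> q(1,2) zq z_other[of i] z_other[of j] i
        by (cases "i = q"; cases "j = q") auto
    qed
    then have "{j \<in> {1..<i}. z i < z j} = {j \<in> {1..<i}. y i < y j}" by blast
    then show ?thesis by (simp add: lehmer_def)
  qed
  ultimately show thesis using that z_perm by blast
qed

lemma lehmer_le: "lehmer w i \<le> i - 1"
proof -
  have "card {j \<in> {1..<i}. w i < w j} \<le> card {1..<i}" by (rule card_mono) auto
  then show ?thesis by (simp add: lehmer_def)
qed

lemma reachable_refl: "x permutes {1..n} \<Longrightarrow> reachable n x x"
  by (rule reachableI)

lemma lehmer_le_imp_pseudoreachable:
  assumes x: "x permutes {1..n}" and "y permutes {1..n}"
    and "\<And>i. i \<in> {1..n} \<Longrightarrow> lehmer y i \<le> lehmer x i"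
  shows "pseudoreachable n x y"
  using assms(2,3)
proof (induction "\<Sum>i\<in>{1..n}. lehmer x i - lehmer y i" arbitrary: y rule: less_induct)
  case less
  note y = less.prems(1) and le = less.prems(2)
  show ?case
  proof (cases "\<forall>i\<in>{1..n}. lehmer x i = lehmer y i")
    case True
    then have "x = y" using lehmer_inject[OF x y] by blast
    then show ?thesis using reachable_refl[OF x] unfolding pseudoreachable_def by blast
  next
    case False
    then obtain p where p: "p \<in> {1..n}" and "lehmer x p \<noteq> lehmer y p" by blast
    then have p_less: "lehmer y p < lehmer x p" using le[OF p] by simp
    then have "lehmer y p < p - 1" using lehmer_le[of x p] by simp
    then obtain z where zy: "reachable n z y" and z: "z permutes {1..n}"
      and z_p: "lehmer z p = Suc (lehmer y p)"
      and z_other: "\<And>i. i \<in> {1..n} \<Longrightarrow> i \<noteq> p \<Longrightarrow> lehmer z i = lehmer y i"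
      using lehmer_increment[OF y p] by blast
    have z_le: "lehmer y i \<le> lehmer z i \<and> lehmer z i \<le> lehmer x i" if "i \<in> {1..n}" for i
      using that le[OF that] p_less z_p z_other[OF that] by (cases "i = p") auto
    have "(\<Sum>i\<in>{1..n}. lehmer x i - lehmer z i) < (\<Sum>i\<in>{1..n}. lehmer x i - lehmer y i)"
    proof (rule sum_strict_mono_ex1)
      show "\<forall>i\<in>{1..n}. lehmer x i - lehmer z i \<le> lehmer x i - lehmer y i"
        using z_le by (simp add: diff_le_mono2)
      show "\<exists>i\<in>{1..n}. lehmer x i - lehmer z i < lehmer x i - lehmer y i"
        using p p_less z_p by (intro bexI[of _ p]) auto
    qed simp
    then have "pseudoreachable n x z" using less.hyps z z_le by blast
    then show ?thesis using zy unfolding pseudoreachable_def by (metis tranclp.trancl_into_trancl)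
  qed
qed

lemma pseudoreachable_imp_lehmer_le:
  assumes "pseudoreachable n x y" "i \<in> {1..n}"
  shows "lehmer y i \<le> lehmer x i"
  using assms(1) unfolding pseudoreachable_def
proof (induction rule: tranclp_induct)
  case (base y)
  then show ?case using assms(2) by (rule reachable_imp_lehmer_le)
next
  case (step y z)
  then show ?case using reachable_imp_lehmer_le[OF step.hyps(2) assms(2)] by simp
qed

theorem theorem7p2:
  fixes n :: nat and x y :: "nat \<Rightarrow> nat"
  assumes "n \<ge> 1" and "x permutes {1..n}" and "y permutes {1..n}"
  shows "pseudoreachable n x y \<longleftrightarrow> bubble_ge n x y"
  unfolding bubble_ge_iff_lehmer[OF assms(2,3,1)]
  using pseudoreachable_imp_lehmer_le lehmer_le_imp_pseudoreachable[OF assms(2,3)] by blast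

end
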